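(* Let $G$ be an abelian group and let $\varphi\in\mathrm{End}(G)$. Then $s(\varphi)=ns(\varphi)+s_0(\varphi)$.
   Context: $\mathbb N=\{0,1,2,\dots\}$ and $\mathbb N_+=\mathbb N\setminus\{0\}$. For an endomorphism $\varphi$ of an abelian group $G$: $Q\mathrm{Per}(\varphi)$ is the set of $x\in G$ such that $\varphi^n(x)=\varphi^m(x)$ for some $n<m$ in $\mathbb N$. A string of $\varphi$ is a sequence $S=\{x_n\}_{n\in\mathbb N}$ of pairwise distinct elements of $G$ with $\varphi(x_n)=x_{n-1}$ for every $n\in\mathbb N_+$. A string is singular if $x_0\in Q\mathrm{Per}(\varphi)$, and non-singular otherwise; it is a null string if $x_0\neq 0$ and $\varphi^k(x_0)=0$ for some $k\in\mathbb N_+$. The numbers $s(\varphi)$, $ns(\varphi)$, $s_0(\varphi)$ are the suprema of $|\mathcal F|$ over all families $\mathcal F$ of pairwise disjoint strings, respectively non-singular strings, respectively null strings, of $\varphi$ in $G$ (disjointness refers to the underlying sets of elements). They take values in $\mathbb N\cup\{\infty\}$: each is set equal to $\infty$ whenever the supremum is infinite, and $a+\infty=\infty+a=\infty$ for every $a\in\mathbb N\cup\{\infty\}$. *)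

theory Defs
  imports Complex_Main "HOL-Library.Extended_Nat" "HOL-Library.Disjoint_Sets"
begin

text \<open>Here an abelian group is a type of class \<^class>\<open>ab_group_add\<close>, and an endomorphism
  of it is a function satisfying the library predicate \<^locale>\<open>additive\<close>.\<close>

definition QPer :: "('a \<Rightarrow> 'a) \<Rightarrow> 'a set" where
  "QPer \<phi> = {x. \<exists>n m. n < m \<and> (\<phi> ^^ n) x = (\<phi> ^^ m) x}"

definition is_string :: "('a \<Rightarrow> 'a) \<Rightarrow> (nat \<Rightarrow> 'a) \<Rightarrow> bool" where
  "is_string \<phi> x \<longleftrightarrow> inj x \<and> (\<forall>n>0. \<phi> (x n) = x (n - 1))"

definition singular_string :: "('a \<Rightarrow> 'a) \<Rightarrow> (nat \<Rightarrow> 'a) \<Rightarrow> bool" where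
  "singular_string \<phi> x \<longleftrightarrow> is_string \<phi> x \<and> x 0 \<in> QPer \<phi>"

definition nonsingular_string :: "('a \<Rightarrow> 'a) \<Rightarrow> (nat \<Rightarrow> 'a) \<Rightarrow> bool" where
  "nonsingular_string \<phi> x \<longleftrightarrow> is_string \<phi> x \<and> \<not> singular_string \<phi> x"

definition null_string :: "('a::zero \<Rightarrow> 'a) \<Rightarrow> (nat \<Rightarrow> 'a) \<Rightarrow> bool" where
  "null_string \<phi> x \<longleftrightarrow> is_string \<phi> x \<and> x 0 \<noteq> 0 \<and> (\<exists>k>0. (\<phi> ^^ k) (x 0) = 0)"

text \<open>The cardinality of a set, with all infinite cardinals identified with \<open>\<infinity>\<close>
  (\<^const>\<open>card\<close> itself is \<open>0\<close> on infinite sets).\<close>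

definition ecard :: "'b set \<Rightarrow> enat" where
  "ecard A = (if finite A then enat (card A) else \<infinity>)"

text \<open>The supremum of the sizes of the families of pairwise disjoint sequences satisfying \<open>P\<close>.
  A family is a set of sequences: since the underlying set \<^term>\<open>range x\<close> of a sequence is
  nonempty, pairwise disjoint members of an indexed family are automatically distinct. The empty
  family is allowed, so the supremum is \<open>0\<close> if no sequence satisfies \<open>P\<close>.\<close>

definition max_disjoint :: "((nat \<Rightarrow> 'a) \<Rightarrow> bool) \<Rightarrow> enat" where
  "max_disjoint P = (SUP F \<in> {F. (\<forall>x\<in>F. P x) \<and> disjoint_family_on range F}. ecard F)"

definition string_number :: "('a \<Rightarrow> 'a) \<Rightarrow> enat" where
  "string_number \<phi> = max_disjoint (is_string \<phi>)"

definition nonsingular_string_number :: "('a \<Rightarrow> 'a) \<Rightarrow> enat" where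
  "nonsingular_string_number \<phi> = max_disjoint (nonsingular_string \<phi>)"

definition null_string_number :: "('a::zero \<Rightarrow> 'a) \<Rightarrow> enat" where
  "null_string_number \<phi> = max_disjoint (null_string \<phi>)"

end

theory Submission
  imports Defs
begin

text \<open>The equation holds because null strings come either not at all or in infinite supply.

  Suppose there is a null string. Applying a power of \<open>\<phi>\<close> turns it into a sequence \<open>z\<close> with
  \<open>\<phi> (z (n + 1)) = z n\<close>, \<open>z 0 \<noteq> 0\<close> and \<open>\<phi> (z 0) = 0\<close>, so that \<open>z n\<close> is killed by exactly \<open>n + 1\<close>
  applications of \<open>\<phi>\<close>. The sequences \<open>n \<mapsto> z (n + j) + z n\<close> for \<open>j \<ge> 1\<close> are again null strings. They
  are pairwise disjoint: the number of applications of \<open>\<phi>\<close> needed to kill an entry determines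
  \<open>n + j\<close>, and then the second summand determines \<open>n\<close>. Hence both sides are \<open>\<infinity>\<close>
  (\<open>null_string_number_dichotomy\<close>).

  Suppose there is none. A singular string \<open>x\<close> with \<open>\<phi>\<^sup>n (x 0) = \<phi>\<^sup>m (x 0)\<close> and \<open>n < m\<close> would yield
  the null string \<open>k \<mapsto> x k - x (k + (m - n))\<close>, so every string is non-singular, and both sides are the
  number of non-singular strings (\<open>singular_string_imp_null_string\<close>).\<close>

lemma additive_funpow:
  fixes \<phi> :: "'a::ab_group_add \<Rightarrow> 'a"
  assumes "additive \<phi>"
  shows "additive (\<phi> ^^ k)"
proof (induction k)
  case 0
  show ?case by (simp add: additive_def)
next
  case (Suc k)
  then show ?case using assms by (simp add: additive_def)
qed

lemma funpow_backward_orbit: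
  fixes \<phi> :: "'a \<Rightarrow> 'a"
  assumes "\<And>n. \<phi> (z (Suc n)) = z n"
  shows "(\<phi> ^^ k) (z (n + k)) = z n"
proof (induction k)
  case (Suc k)
  then show ?case using assms by (simp add: funpow_swap1)
qed simp

text \<open>A repetition in a backward orbit makes its first entry periodic. A periodic point that is
  eventually mapped to zero is zero, so a null string is injective for free.\<close>

lemma null_stringI:
  fixes \<phi> :: "'a::ab_group_add \<Rightarrow> 'a"
  assumes "additive \<phi>"
    and step: "\<And>n. \<phi> (z (Suc n)) = z n"
    and nz: "z 0 \<noteq> 0"
    and kill: "(\<phi> ^^ k) (z 0) = 0"
  shows "null_string \<phi> z"
proof -
  have no_return: "z i \<noteq> z j" if "i < j" for i j
  proof
    assume eq: "z i = z j"
    define d where "d = j - i"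
    have j: "j = d + i" and d: "d > 0" using that by (simp_all add: d_def)
    have "(\<phi> ^^ i) (z (0 + i)) = (\<phi> ^^ i) (z (d + i))" using eq j by simp
    then have "z 0 = z d" using funpow_backward_orbit[of \<phi> z, OF step] by metis
    moreover have "(\<phi> ^^ d) (z (0 + d)) = z 0" by (rule funpow_backward_orbit[of \<phi> z, OF step])
    ultimately have "(\<phi> ^^ d) (z 0) = z 0" by simp
    then have period: "(\<phi> ^^ (d * r)) (z 0) = z 0" for r
      by (induction r) (simp_all add: funpow_add)
    have "d * k = (d * k - k) + k" using d by simp
    then have "z 0 = (\<phi> ^^ (d * k - k)) ((\<phi> ^^ k) (z 0))"
      using period[of k] by (metis funpow_add comp_apply)
    also have "\<dots> = 0"
      using kill additive.zero[OF additive_funpow[OF assms(1)]] by simp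
    finally show False using nz by simp
  qed
  have "inj z"
    by (rule injI) (metis no_return linorder_neqE_nat)
  moreover have "\<phi> (z n) = z (n - 1)" if "n > 0" for n
    using that step[of "n - 1"] by simp
  moreover have "k > 0"
    using nz kill by (cases k) auto
  ultimately show ?thesis
    using nz kill by (auto simp: null_string_def is_string_def)
qed

text \<open>Quasi-periodicity of the first entry says that the difference between the string and its
  shift by the period is eventually mapped to zero.\<close>

lemma singular_string_imp_null_string:
  fixes \<phi> :: "'a::ab_group_add \<Rightarrow> 'a"
  assumes "additive \<phi>" and "singular_string \<phi> x"
  shows "\<exists>z. null_string \<phi> z"
proof -
  have inj: "inj x" and step: "\<phi> (x (Suc n)) = x n" for n
    using assms(2) by (auto simp: singular_string_def is_string_def)
  obtain n m where "n < m" and eq: "(\<phi> ^^ n) (x 0) = (\<phi> ^^ m) (x 0)"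
    using assms(2) by (auto simp: singular_string_def QPer_def)
  define p where "p = m - n"
  have p: "p > 0" and m: "m = n + p" using \<open>n < m\<close> by (simp_all add: p_def)
  define z where "z = (\<lambda>k. x k - x (k + p))"
  have "(\<phi> ^^ m) (x (0 + p)) = (\<phi> ^^ n) ((\<phi> ^^ p) (x (0 + p)))"
    by (simp add: m funpow_add)
  also have "\<dots> = (\<phi> ^^ n) (x 0)"
    by (simp only: funpow_backward_orbit[of \<phi> x, OF step])
  finally have "(\<phi> ^^ m) (z 0) = 0"
    using eq additive.diff[OF additive_funpow[OF assms(1)]] by (simp add: z_def)
  moreover have "\<phi> (z (Suc k)) = z k" for k
    using step[of k] step[of "k + p"] additive.diff[OF assms(1)] by (simp add: z_def)
  moreover have "z 0 \<noteq> 0"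
    using inj p by (auto simp: z_def dest: injD)
  ultimately have "null_string \<phi> z"
    using assms(1) by (intro null_stringI)
  then show ?thesis by blast
qed

text \<open>With the least exponent that kills the first entry of a null string, the image of the string
  under the preceding power of \<open>\<phi>\<close> starts in the kernel but not at zero.\<close>

lemma null_string_from_kernel:
  fixes \<phi> :: "'a::ab_group_add \<Rightarrow> 'a"
  assumes "additive \<phi>" and "null_string \<phi> x"
  obtains z where "null_string \<phi> z" and "\<phi> (z 0) = 0"
proof -
  have step: "\<phi> (x (Suc n)) = x n" for n
    using assms(2) by (auto simp: null_string_def is_string_def)
  obtain k where "(\<phi> ^^ k) (x 0) = 0" and "x 0 \<noteq> 0"
    using assms(2) by (auto simp: null_string_def)
  then obtain l where l: "(\<phi> ^^ l) (x 0) \<noteq> 0" "(\<phi> ^^ Suc l) (x 0) = 0"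
    using ex_least_nat_less[of "\<lambda>k. (\<phi> ^^ k) (x 0) = 0" k] by auto
  define z where "z = (\<lambda>n. (\<phi> ^^ l) (x n))"
  have "\<phi> (z (Suc n)) = z n" for n
    by (metis z_def step funpow_swap1)
  moreover have "z 0 \<noteq> 0" and "\<phi> (z 0) = 0"
    using l by (simp_all add: z_def)
  ultimately have "null_string \<phi> z"
    using assms(1) by (intro null_stringI[where k = 1]) auto
  then show thesis using \<open>\<phi> (z 0) = 0\<close> by (rule that)
qed

lemma infinite_disjoint_null_strings:
  fixes \<phi> :: "'a::ab_group_add \<Rightarrow> 'a"
  assumes "additive \<phi>" and "null_string \<phi> x"
  obtains F where "\<forall>w\<in>F. null_string \<phi> w" and "disjoint_family_on range F" and "infinite F"
proof -
  obtain z where z: "null_string \<phi> z" and ker: "\<phi> (z 0) = 0"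
    using null_string_from_kernel[OF assms] .
  have inj: "inj z" and nz: "z 0 \<noteq> 0" and step: "\<phi> (z (Suc n)) = z n" for n
    using z by (auto simp: null_string_def is_string_def)
  have zero: "(\<phi> ^^ k) 0 = 0" for k
    by (rule additive.zero[OF additive_funpow[OF assms(1)]])
  have add: "(\<phi> ^^ k) (a + b) = (\<phi> ^^ k) a + (\<phi> ^^ k) b" for k a b
    by (rule additive.add[OF additive_funpow[OF assms(1)]])
  have down: "(\<phi> ^^ n) (z n) = z 0" for n
    using funpow_backward_orbit[of \<phi> z n 0, OF step] by simp
  have kill: "(\<phi> ^^ k) (z n) = 0" if "n < k" for n k
  proof -
    have "k = (k - Suc n) + (1 + n)" using that by simp
    then have "(\<phi> ^^ k) (z n) = (\<phi> ^^ (k - Suc n)) (\<phi> ((\<phi> ^^ n) (z n)))"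
      by (metis funpow_add comp_apply funpow.simps(2) plus_1_eq_Suc)
    then show ?thesis by (simp add: down ker zero)
  qed
  \<comment> \<open>The shift is taken to be positive so that \<open>z (n + Suc j)\<close> survives longer than \<open>z n\<close>.\<close>
  define w where "w = (\<lambda>j n. z (n + Suc j) + z n)"
  have top: "(\<phi> ^^ (n + Suc j)) (w j n) = z 0" for j n
    unfolding w_def add down by (subst kill) simp_all
  have w_kill: "(\<phi> ^^ k) (w j n) = 0" if "n + Suc j < k" for j n k
    using that by (simp add: w_def add kill)
  have disj: "j = i" if eq: "w j n = w i m" for i j n m
  proof -
    have "n + Suc j = m + Suc i"
      using top w_kill eq nz by (metis linorder_neqE_nat)
    moreover from this have "z n = z m" using eq by (simp add: w_def)
    then have "n = m" using inj by (auto dest: injD)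
    ultimately show ?thesis by simp
  qed
  have null: "null_string \<phi> (w j)" for j
  proof (rule null_stringI[OF assms(1)])
    show "\<phi> (w j (Suc n)) = w j n" for n
      using step additive.add[OF assms(1)] by (simp add: w_def)
    show "w j 0 \<noteq> 0" using top[of 0 j] nz zero by metis
    show "(\<phi> ^^ Suc (Suc j)) (w j 0) = 0" by (rule w_kill) simp
  qed
  have "inj w" by (rule injI) (metis disj)
  then have "infinite (range w)" by (rule range_inj_infinite)
  moreover have "disjoint_family_on range (range w)"
    unfolding disjoint_family_on_def using disj by blast
  ultimately show thesis using null that[of "range w"] by blast
qed

lemma max_disjoint_mono:
  assumes "\<And>x. P x \<Longrightarrow> Q x"
  shows "max_disjoint P \<le> max_disjoint Q"
  unfolding max_disjoint_def using assms by (intro SUP_subset_mono) auto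

lemma max_disjoint_eq_infinity:
  assumes "\<forall>x\<in>F. P x" and "disjoint_family_on range F" and "infinite F"
  shows "max_disjoint P = \<infinity>"
proof -
  have "ecard F \<le> max_disjoint P"
    unfolding max_disjoint_def using assms by (intro SUP_upper) auto
  then show ?thesis using assms(3) by (simp add: ecard_def)
qed

lemma max_disjoint_eq_0:
  assumes "\<And>x. \<not> P x"
  shows "max_disjoint P = 0"
proof -
  have "{F. (\<forall>x\<in>F. P x) \<and> disjoint_family_on range F} = {{}}"
    using assms by (auto simp: disjoint_family_on_def)
  then show ?thesis by (simp add: max_disjoint_def ecard_def zero_enat_def)
qed

lemma null_string_number_dichotomy:
  fixes \<phi> :: "'a::ab_group_add \<Rightarrow> 'a"
  assumes "additive \<phi>"
  shows "null_string_number \<phi> = (if \<exists>x. null_string \<phi> x then \<infinity> else 0)"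
proof (cases "\<exists>x. null_string \<phi> x")
  case True
  then obtain F where "\<forall>w\<in>F. null_string \<phi> w" "disjoint_family_on range F" "infinite F"
    using infinite_disjoint_null_strings[OF assms] by metis
  then have "null_string_number \<phi> = \<infinity>"
    unfolding null_string_number_def by (rule max_disjoint_eq_infinity)
  with True show ?thesis by simp
next
  case False
  then show ?thesis by (simp add: null_string_number_def max_disjoint_eq_0)
qed

theorem theorem3p15:
  fixes \<phi> :: "'a::ab_group_add \<Rightarrow> 'a"
  assumes "additive \<phi>"
  shows "string_number \<phi> = nonsingular_string_number \<phi> + null_string_number \<phi>"
proof (cases "\<exists>x. null_string \<phi> x")
  case True
  then have inf: "null_string_number \<phi> = \<infinity>"
    using null_string_number_dichotomy[OF assms] by simp
  have "null_string_number \<phi> \<le> string_number \<phi>"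
    unfolding null_string_number_def string_number_def
    by (rule max_disjoint_mono) (simp add: null_string_def)
  then show ?thesis using inf by simp
next
  case False
  then have "\<not> singular_string \<phi> x" for x
    using singular_string_imp_null_string[OF assms] by blast
  then have "nonsingular_string \<phi> = is_string \<phi>"
    by (auto simp: fun_eq_iff nonsingular_string_def)
  then show ?thesis
    using False null_string_number_dichotomy[OF assms]
    by (simp add: string_number_def nonsingular_string_number_def)
qed

end
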